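(* Let $x_1,\dots,x_n\in\mathbb{R}^p$ be data points, $c\ge2$, $\mathcal I\subset(1,\infty)$ the interval of fuzzifier values under consideration, $t$ a threshold, $u_{ij}(m)$ ($1\le i\le n$, $1\le j\le c$, $m\in\mathcal I$) the fuzzy memberships and $G_t(m)$ the associated graph. Define $$\mathcal T=\{m\in\mathcal I:\ \exists (i,j)\text{ such that }u_{ij}(m)=t\},\qquad N_{ij}(t)=\#\{m\in\mathcal I: u_{ij}(m)=t\}.$$ Assume that each membership function $m\mapsto u_{ij}(m)$ is continuous on $\mathcal I$. Then the following statements hold. (i) $G_t(m)$ can change only at values $m\in\mathcal T$. Equivalently, $G_t(m)$ is constant on every connected component of $\mathcal I\setminus\mathcal T$. (ii) If $N_{ij}(t)<\infty$ for every pair $(i,j)$, then $|\mathcal T|\le\sum_{i=1}^n\sum_{j=1}^c N_{ij}(t)$. (iii) If $N_{ij}(t)\le 1$ for all $(i,j)$, then $|\mathcal T|\le nc$. (iv) If $\mathcal T$ is finite and bounded above in $\mathcal I$, and if $m^{**}:=\sup\mathcal T$, then $G_t(m)$ is constant on $\mathcal I\cap(m^{**},\infty)$.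
   Context: Memberships: $u_{ij}(m)\in[0,1]$ is the degree of membership of the data point $x_i$ in cluster $j$ at fuzzifier $m$, produced by fuzzy clustering with centres $v_j(m)\in\mathbb{R}^p$: $u_{ij}(m)=\left[\sum_{k=1}^{c}(d_{ij}(m)/d_{ik}(m))^{2/(m-1)}\right]^{-1}$. Here the distances $d_{ij}(m)$ are either $\|x_i-v_j(m)\|$ (Shape Fuzzy C-Mean, SFCM) or $\sqrt{(x_i-v_j(m))^\top A_j(m)(x_i-v_j(m))}$ with cluster-adaptive matrices $A_j(m)$ (Gustafson-Kessel Mapper, GK-Mapper). Graph: let $C_j(t,m)=\{x_i:u_{ij}(m)\ge t\}$. The graph $G_t(m)$ has vertex set $\{1,\dots,c\}$ and, for $a\neq b$, an (undirected) edge $(a,b)$ if and only if $C_a(t,m)\cap C_b(t,m)\ne\emptyset$, i.e. there is an $i$ with $u_{ia}(m)\ge t$ and $u_{ib}(m)\ge t$. *)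

theory Defs
  imports "HOL-Analysis.Analysis" "HOL-Library.Extended_Nat"
begin

text \<open>Throughout, \<open>i\<close> indexes data points, \<open>j\<close> and \<open>k\<close> index clusters, and \<open>m\<close> is the fuzzifier.\<close>

definition sfcm_dist ::
  "(nat \<Rightarrow> real ^ 'p) \<Rightarrow> (nat \<Rightarrow> real \<Rightarrow> real ^ 'p) \<Rightarrow> nat \<Rightarrow> nat \<Rightarrow> real \<Rightarrow> real" where
  "sfcm_dist x v i j m = norm (x i - v j m)"

definition gk_dist ::
  "(nat \<Rightarrow> real ^ 'p) \<Rightarrow> (nat \<Rightarrow> real \<Rightarrow> real ^ 'p) \<Rightarrow> (nat \<Rightarrow> real \<Rightarrow> real ^ 'p ^ 'p)
    \<Rightarrow> nat \<Rightarrow> nat \<Rightarrow> real \<Rightarrow> real" where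
  "gk_dist x v A i j m = sqrt ((x i - v j m) \<bullet> (A j m *v (x i - v j m)))"

text \<open>The membership formula is meaningful only if all distances from the data point to the
  centres are positive. Where one vanishes (or the radicand of \<^const>\<open>gk_dist\<close> is negative), no
  convention is fixed, and the value is only required to lie in \<open>[0, 1]\<close>; in particular the value produced by \<open>r / 0 = 0\<close> is never used.\<close>

definition fuzzy_memberships ::
  "nat \<Rightarrow> nat \<Rightarrow> real set \<Rightarrow> (nat \<Rightarrow> nat \<Rightarrow> real \<Rightarrow> real) \<Rightarrow> (nat \<Rightarrow> nat \<Rightarrow> real \<Rightarrow> real) \<Rightarrow> bool" where
  "fuzzy_memberships n c I d u \<longleftrightarrow>
    (\<forall>i\<in>{1..n}. \<forall>j\<in>{1..c}. \<forall>m\<in>I.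
      u i j m \<in> {0..1} \<and>
      ((\<forall>k\<in>{1..c}. d i k m > 0) \<longrightarrow>
        u i j m = inverse (\<Sum>k=1..c. (d i j m / d i k m) powr (2 / (m - 1)))))"

text \<open>Data points are identified with their indices, so that coinciding points \<open>x i = x i'\<close>
  with \<open>i \<noteq> i'\<close> remain different data points.\<close>

definition fuzzy_cluster ::
  "nat \<Rightarrow> (nat \<Rightarrow> nat \<Rightarrow> real \<Rightarrow> real) \<Rightarrow> real \<Rightarrow> nat \<Rightarrow> real \<Rightarrow> nat set" where
  "fuzzy_cluster n u t j m = {i \<in> {1..n}. u i j m \<ge> t}"

text \<open>An undirected graph is the pair of its vertex set and its set of two-element edges.\<close>

definition fuzzy_graph ::
  "nat \<Rightarrow> nat \<Rightarrow> (nat \<Rightarrow> nat \<Rightarrow> real \<Rightarrow> real) \<Rightarrow> real \<Rightarrow> real \<Rightarrow> nat set \<times> nat set set" where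
  "fuzzy_graph n c u t m =
    ({1..c},
     {{a, b} | a b. a \<in> {1..c} \<and> b \<in> {1..c} \<and> a \<noteq> b \<and>
        fuzzy_cluster n u t a m \<inter> fuzzy_cluster n u t b m \<noteq> {}})"

definition crossing_set ::
  "nat \<Rightarrow> nat \<Rightarrow> real set \<Rightarrow> (nat \<Rightarrow> nat \<Rightarrow> real \<Rightarrow> real) \<Rightarrow> real \<Rightarrow> real set" where
  "crossing_set n c I u t = {m \<in> I. \<exists>i\<in>{1..n}. \<exists>j\<in>{1..c}. u i j m = t}"

text \<open>Unlike \<^const>\<open>card\<close>, this is \<open>\<infinity>\<close> on infinite sets.\<close>

definition ecard :: "'a set \<Rightarrow> enat" where
  "ecard S = (if finite S then enat (card S) else \<infinity>)"

definition crossing_number ::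
  "real set \<Rightarrow> (nat \<Rightarrow> nat \<Rightarrow> real \<Rightarrow> real) \<Rightarrow> real \<Rightarrow> nat \<Rightarrow> nat \<Rightarrow> enat" where
  "crossing_number I u t i j = ecard {m \<in> I. u i j m = t}"

text \<open>\<open>f\<close> changes at \<open>m\<close> if it is not constant on any neighbourhood of \<open>m\<close> in \<open>S\<close>.\<close>

definition changes_at :: "(real \<Rightarrow> 'b) \<Rightarrow> real set \<Rightarrow> real \<Rightarrow> bool" where
  "changes_at f S m \<longleftrightarrow> \<not> (\<forall>\<^sub>F m' in at m within S. f m' = f m)"

end

theory Submission
  imports Defs
begin

text \<open>The graph depends on the fuzzifier only through the truth values of the finitely many
  comparisons \<open>t \<le> u i j m\<close> (\<open>fuzzy_graph_cong\<close>). A continuous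
  function on a connected set cannot move from one side of \<open>t\<close> to the other without
  taking the value \<open>t\<close>, so these truth values, and with them the graph, are frozen on
  connected sets that avoid the crossing set (\<open>fuzzy_graph_constant_on_connected\<close>). The
  same reasoning in a neighbourhood of a single point gives
  \<open>fuzzy_graph_changes_at_imp_crossing\<close>. The two bounds are subadditivity of
  cardinality, the crossing set being the union of the level sets of the pairs
  (\<open>ecard_crossing_set_le\<close>). The part of \<open>I\<close> above the supremum of the
  crossing set is an interval free of crossings, hence another instance of constancy on connected
  sets.\<close>

lemma fuzzy_graph_cong:
  assumes "\<And>i j. i \<in> {1..n} \<Longrightarrow> j \<in> {1..c} \<Longrightarrow> t \<le> u i j m \<longleftrightarrow> t \<le> u i j m'"
  shows "fuzzy_graph n c u t m = fuzzy_graph n c u t m'"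
proof -
  have "fuzzy_cluster n u t j m = fuzzy_cluster n u t j m'" if "j \<in> {1..c}" for j
    using assms that unfolding fuzzy_cluster_def by blast
  then show ?thesis
    unfolding fuzzy_graph_def by (auto; blast)
qed

lemma connected_avoiding_imp_same_side:
  fixes f :: "'a::topological_space \<Rightarrow> 'b::linorder_topology"
  assumes "connected K" and "continuous_on K f" and "\<And>z. z \<in> K \<Longrightarrow> f z \<noteq> t"
    and "x \<in> K" and "y \<in> K" and "t \<le> f x"
  shows "t \<le> f y"
proof (rule ccontr)
  assume "\<not> t \<le> f y"
  moreover have "connected (f ` K)"
    using assms by (intro connected_continuous_image)
  ultimately have "t \<in> f ` K"
    using assms(4-6) connectedD_interval[of "f ` K" "f y" "f x" t] by auto
  with assms(3) show False
    by auto
qed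

text \<open>Stated for any connected \<open>K\<close>, so that it serves both the components of the
  complement of the crossing set and the tail above its supremum.\<close>

lemma fuzzy_graph_constant_on_connected:
  assumes "\<And>i j. i \<in> {1..n} \<Longrightarrow> j \<in> {1..c} \<Longrightarrow> continuous_on I (u i j)"
    and "connected K" and "K \<subseteq> I - crossing_set n c I u t"
  shows "fuzzy_graph n c u t constant_on K"
proof -
  have side: "t \<le> u i j m'"
    if "i \<in> {1..n}" "j \<in> {1..c}" "m \<in> K" "m' \<in> K" "t \<le> u i j m" for i j m m'
  proof (rule connected_avoiding_imp_same_side[where K = K and f = "u i j"])
    show "continuous_on K (u i j)"
      using assms that continuous_on_subset by blast
    show "u i j z \<noteq> t" if "z \<in> K" for z
      using assms(3) that \<open>i \<in> {1..n}\<close> \<open>j \<in> {1..c}\<close> unfolding crossing_set_def by blast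
  qed (use assms that in auto)
  \<comment> \<open>\<open>side\<close> is an implication from \<open>m\<close> to
    \<open>m'\<close>; used with both orders of the two points, it gives the equivalence.\<close>
  have "fuzzy_graph n c u t m = fuzzy_graph n c u t m'" if "m \<in> K" "m' \<in> K" for m m'
    using side that by (intro fuzzy_graph_cong) blast
  then show ?thesis
    unfolding constant_on_def by blast
qed

text \<open>Away from a crossing every membership lies strictly on one side of \<open>t\<close>, an
  open condition that continuity preserves near \<open>m\<close> within \<open>I\<close>.\<close>

lemma fuzzy_graph_changes_at_imp_crossing:
  assumes "\<And>i j. i \<in> {1..n} \<Longrightarrow> j \<in> {1..c} \<Longrightarrow> continuous_on I (u i j)"
    and "m \<in> I" and "changes_at (fuzzy_graph n c u t) I m"
  shows "m \<in> crossing_set n c I u t"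
proof (rule ccontr)
  assume no_crossing: "m \<notin> crossing_set n c I u t"
  have "\<forall>\<^sub>F m' in at m within I. t \<le> u i j m' \<longleftrightarrow> t \<le> u i j m"
    if "i \<in> {1..n}" "j \<in> {1..c}" for i j
  proof -
    have lim: "(u i j \<longlongrightarrow> u i j m) (at m within I)"
      using assms that unfolding continuous_on_def by blast
    have "u i j m \<noteq> t"
      using no_crossing that \<open>m \<in> I\<close> unfolding crossing_set_def by blast
    then consider "u i j m < t" | "t < u i j m"
      by linarith
    then show ?thesis
    proof cases
      case 1
      from order_tendstoD(2)[OF lim 1] show ?thesis
        by eventually_elim (use 1 in auto)
    next
      case 2
      from order_tendstoD(1)[OF lim 2] show ?thesis
        by eventually_elim (use 2 in auto)
    qed
  qed
  \<comment> \<open>There are finitely many pairs, so one neighbourhood works for all of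
    them.\<close>
  then have "\<forall>\<^sub>F m' in at m within I.
      \<forall>i\<in>{1..n}. \<forall>j\<in>{1..c}. t \<le> u i j m' \<longleftrightarrow> t \<le> u i j m"
    by (intro eventually_ball_finite ballI) auto
  then have "\<forall>\<^sub>F m' in at m within I. fuzzy_graph n c u t m' = fuzzy_graph n c u t m"
    by eventually_elim (intro fuzzy_graph_cong, blast)
  with assms(3) show False
    unfolding changes_at_def by blast
qed

text \<open>If either set is infinite the right side is \<open>\<infinity>\<close>; otherwise this
  is the bound for \<open>card\<close>.\<close>

lemma ecard_Un_le: "ecard (S \<union> T) \<le> ecard S + ecard T"
  by (simp add: ecard_def card_Un_le)

lemma ecard_UN_le: "finite J \<Longrightarrow> ecard (\<Union>j\<in>J. S j) \<le> (\<Sum>j\<in>J. ecard (S j))"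
proof (induction J rule: finite_induct)
  case empty
  show ?case
    by (simp add: ecard_def zero_enat_def)
next
  case (insert k J)
  have "ecard (\<Union>j\<in>insert k J. S j) \<le> ecard (S k) + ecard (\<Union>j\<in>J. S j)"
    using ecard_Un_le by simp
  also have "\<dots> \<le> (\<Sum>j\<in>insert k J. ecard (S j))"
    using insert by (simp add: add_left_mono)
  finally show ?case .
qed

text \<open>A fuzzifier at which several memberships equal \<open>t\<close> counts once on the left
  but once per pair on the right, hence an inequality.\<close>

lemma ecard_crossing_set_le:
  "ecard (crossing_set n c I u t) \<le> (\<Sum>i=1..n. \<Sum>j=1..c. crossing_number I u t i j)"
proof -
  have "crossing_set n c I u t = (\<Union>i\<in>{1..n}. \<Union>j\<in>{1..c}. {m \<in> I. u i j m = t})"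
    unfolding crossing_set_def by blast
  also have "ecard \<dots> \<le> (\<Sum>i=1..n. ecard (\<Union>j\<in>{1..c}. {m \<in> I. u i j m = t}))"
    by (intro ecard_UN_le) simp
  also have "\<dots> \<le> (\<Sum>i=1..n. \<Sum>j=1..c. crossing_number I u t i j)"
    unfolding crossing_number_def by (intro sum_mono ecard_UN_le) simp
  finally show ?thesis .
qed

lemma ecard_crossing_set_le_mult:
  assumes "\<And>i j. i \<in> {1..n} \<Longrightarrow> j \<in> {1..c} \<Longrightarrow> crossing_number I u t i j \<le> 1"
  shows "ecard (crossing_set n c I u t) \<le> enat (n * c)"
proof -
  have "ecard (crossing_set n c I u t) \<le> (\<Sum>i=1..n. \<Sum>j=1..c. crossing_number I u t i j)"
    by (rule ecard_crossing_set_le)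
  also have "\<dots> \<le> (\<Sum>i=1..n. \<Sum>j=1..c. 1)"
    using assms by (intro sum_mono)
  also have "\<dots> = enat (n * c)"
    by (simp add: of_nat_eq_enat)
  finally show ?thesis .
qed

text \<open>An up-closed part of an interval is an interval. The supremum is taken in
  \<open>ereal\<close>: for an empty crossing set it is \<open>-\<infinity>\<close>, and the set is
  all of \<open>I\<close>.\<close>

lemma connected_above_crossing_set:
  assumes "is_interval I"
  shows "connected {m \<in> I. (SUP s \<in> crossing_set n c I u t. ereal s) < ereal m}"
    (is "connected {m \<in> I. ?M < ereal m}")
proof -
  have "is_interval {m \<in> I. ?M < ereal m}"
    unfolding is_interval_1
  proof (intro ballI allI impI)
    fix a b z
    assume ab: "a \<in> {m \<in> I. ?M < ereal m}" "b \<in> {m \<in> I. ?M < ereal m}" and z: "a \<le> z \<and> z \<le> b"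
    then have "z \<in> I"
      using assms unfolding is_interval_1 by blast
    moreover have "?M < ereal z"
      using ab z by (auto intro: less_le_trans)
    ultimately show "z \<in> {m \<in> I. ?M < ereal m}"
      by simp
  qed
  then show ?thesis
    by (rule is_interval_connected)
qed

lemma fuzzy_graph_constant_on_above_crossing_set:
  assumes "\<And>i j. i \<in> {1..n} \<Longrightarrow> j \<in> {1..c} \<Longrightarrow> continuous_on I (u i j)" and "is_interval I"
  shows "fuzzy_graph n c u t constant_on
    {m \<in> I. (SUP s \<in> crossing_set n c I u t. ereal s) < ereal m}"
proof (rule fuzzy_graph_constant_on_connected[OF assms(1) connected_above_crossing_set[OF assms(2)]])
  show "{m \<in> I. (SUP s \<in> crossing_set n c I u t. ereal s) < ereal m}
      \<subseteq> I - crossing_set n c I u t"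
    \<comment> \<open>A crossing is at most the supremum, so it cannot lie strictly above
      it.\<close>
    using SUP_upper[of _ "crossing_set n c I u t" ereal] by (auto simp flip: not_le)
qed

theorem theorem4:
  fixes x :: "nat \<Rightarrow> real ^ 'p"
    and v :: "nat \<Rightarrow> real \<Rightarrow> real ^ 'p"
    and A :: "nat \<Rightarrow> real \<Rightarrow> real ^ 'p ^ 'p"
    and d u :: "nat \<Rightarrow> nat \<Rightarrow> real \<Rightarrow> real"
    and n c :: nat
    and I :: "real set"
    and t :: real
  assumes "c \<ge> 2"
    and "is_interval I" and "I \<subseteq> {1<..}"
    and "d = sfcm_dist x v \<or> d = gk_dist x v A"
    and "fuzzy_memberships n c I d u"
    and "\<And>i j. i \<in> {1..n} \<Longrightarrow> j \<in> {1..c} \<Longrightarrow> continuous_on I (u i j)"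
  shows
    "((\<forall>m\<in>I. changes_at (fuzzy_graph n c u t) I m \<longrightarrow> m \<in> crossing_set n c I u t) \<and>
      (\<forall>K \<in> components (I - crossing_set n c I u t). fuzzy_graph n c u t constant_on K)) \<and>
     ((\<forall>i\<in>{1..n}. \<forall>j\<in>{1..c}. crossing_number I u t i j < \<infinity>) \<longrightarrow>
      ecard (crossing_set n c I u t) \<le> (\<Sum>i=1..n. \<Sum>j=1..c. crossing_number I u t i j)) \<and>
     ((\<forall>i\<in>{1..n}. \<forall>j\<in>{1..c}. crossing_number I u t i j \<le> 1) \<longrightarrow>
      ecard (crossing_set n c I u t) \<le> enat (n * c)) \<and>
     (finite (crossing_set n c I u t) \<and> (\<exists>b\<in>I. \<forall>m \<in> crossing_set n c I u t. m \<le> b) \<longrightarrow>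
      fuzzy_graph n c u t constant_on {m \<in> I. (SUP s \<in> crossing_set n c I u t. ereal s) < ereal m})"
proof (intro conjI ballI impI)
  show "m \<in> crossing_set n c I u t"
    if "m \<in> I" "changes_at (fuzzy_graph n c u t) I m" for m
    using assms(6) that by (rule fuzzy_graph_changes_at_imp_crossing)
  show "fuzzy_graph n c u t constant_on K"
    if "K \<in> components (I - crossing_set n c I u t)" for K
    using assms(6) in_components_connected[OF that] in_components_subset[OF that]
    by (rule fuzzy_graph_constant_on_connected)
  show "ecard (crossing_set n c I u t) \<le> (\<Sum>i=1..n. \<Sum>j=1..c. crossing_number I u t i j)"
    by (rule ecard_crossing_set_le)
  show "ecard (crossing_set n c I u t) \<le> enat (n * c)"
    if "\<forall>i\<in>{1..n}. \<forall>j\<in>{1..c}. crossing_number I u t i j \<le> 1"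
    using that by (intro ecard_crossing_set_le_mult) blast
  show "fuzzy_graph n c u t constant_on
      {m \<in> I. (SUP s \<in> crossing_set n c I u t. ereal s) < ereal m}"
    using assms(6,2) by (rule fuzzy_graph_constant_on_above_crossing_set)
qed

end
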